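(* Let $\Phi$ be a reduced crystallographic root system with simple roots $\alpha_1,\dots,\alpha_n$, Weyl group $W$ and simple reflections $S=\{s_1,\dots,s_n\}$. Let $I\subseteq\{1,\dots,n\}$ be an arbitrary subset (the active set) and let $J=\{1,\dots,n\}\setminus I$ be its complement. Then there is a canonical bijection between the set of all configurations reachable in the Modified Kostant Game with active set $I$ and the set $W^J$ of minimal length representatives of the cosets $W/W_J$. Specifically: (1) a sequence $(k_1,\dots,k_m)$ of vertices is a valid firing sequence (starting from the zero configuration) if and only if $s_{k_m}s_{k_{m-1}}\cdots s_{k_1}$ is a reduced expression of an element of $W^J$; (2) sending the configuration reached by a valid firing sequence $(k_1,\dots,k_m)$ to the element $w=s_{k_m}\cdots s_{k_1}$ gives a well-defined bijection from the set of reachable configurations onto $W^J$.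
   Context: Let $E$ be a Euclidean space with inner product $\langle\cdot,\cdot\rangle$, $\Phi\subset E$ a reduced crystallographic root system with base $\alpha_1,\dots,\alpha_n$ and positive roots $\Phi^+$. For a root $\alpha$ put $\alpha^\vee=2\alpha/\langle\alpha,\alpha\rangle$. The Weyl group $W$ is generated by the simple reflections $s_i(\lambda)=\lambda-\langle\lambda,\alpha_i^\vee\rangle\alpha_i$; $\ell$ is the length function with respect to $S=\{s_1,\dots,s_n\}$, and an expression $s_{i_1}\cdots s_{i_k}$ is reduced if its length $k$ equals $\ell$ of the product. The inversion set of $w$ is $\mathcal I(w)=\Phi^+\cap w^{-1}(-\Phi^+)$. Indices $i\in\{1,\dots,n\}$ are identified with simple reflections $s_i$ and with vertices of the Dynkin diagram. For $J\subseteq\{1,\dots,n\}$, $W_J$ is the subgroup generated by $\{s_j: j\in J\}$, $\Phi_J^+=\Phi^+\cap\mathrm{Span}_{\mathbb R}\{\alpha_j: j\in J\}$, and $W^J=\{w\in W:\mathcal I(w)\subseteq\Phi^+\setminus\Phi_J^+\}=\{w\in W:\ell(ws_j)>\ell(w)\text{ for all }j\in J\}$. Modified Kostant Game with active set $I$: a configuration is a vector $c=(c_1,\dots,c_n)\in\mathbb Z_{\ge0}^n$. For a vertex $v$, let $N(v)$ be the set of its neighbours in the Dynkin diagram, and for $u\in N(v)$ let $n_{v,u}=-\langle\alpha_u,\alpha_v^\vee\rangle$ (so $n_{v,u}=1$ if $\alpha_v$ is at least as long as $\alpha_u$, and $n_{v,u}\in\{2,3\}$, the number of edges joining $u$ and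 $v$, if $\alpha_v$ is shorter than $\alpha_u$). Let $\epsilon_v=1$ if $v\in I$ and $\epsilon_v=0$ otherwise. The vertex $v$ is sad in $c$ if $c_v<\tfrac12\left(\sum_{u\in N(v)}n_{v,u}c_u+\epsilon_v\right)$. A sad vertex $v$ may be fired; this replaces $c_v$ by $\sum_{u\in N(v)}n_{v,u}c_u+\epsilon_v-c_v$ and leaves all other entries unchanged. The game starts from $c^{(0)}=\mathbf 0$. A sequence $(k_1,\dots,k_m)$ of vertices is a valid firing sequence if, starting from $\mathbf 0$ and firing $k_1,\dots,k_m$ successively, each $k_j$ is sad at the moment it is fired. A configuration is reachable if it results from some (possibly empty) valid firing sequence. *)

theory Defs
  imports "HOL-Analysis.Analysis" "HOL-Algebra.Generated_Groups" "HOL-Algebra.Bij"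
begin

definition coroot :: "'a::euclidean_space \<Rightarrow> 'a" where
  "coroot \<alpha> = (2 / (\<alpha> \<bullet> \<alpha>)) *\<^sub>R \<alpha>"

definition reflection :: "'a::euclidean_space \<Rightarrow> 'a \<Rightarrow> 'a" where
  "reflection \<alpha> x = x - (x \<bullet> coroot \<alpha>) *\<^sub>R \<alpha>"

text \<open>The roots are not required to span the ambient space. If they do not, then they form a
  root system in their span, and everything below acts trivially on the orthogonal complement;
  in this way root systems of rank 0 are included as well.\<close>

definition root_system :: "'a::euclidean_space set \<Rightarrow> bool" where
  "root_system \<Phi> \<longleftrightarrow> finite \<Phi> \<and> 0 \<notin> \<Phi> \<and> (\<forall>\<alpha>\<in>\<Phi>. reflection \<alpha> ` \<Phi> = \<Phi>)"

definition crystallographic :: "'a::euclidean_space set \<Rightarrow> bool" where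
  "crystallographic \<Phi> \<longleftrightarrow> (\<forall>\<alpha>\<in>\<Phi>. \<forall>\<beta>\<in>\<Phi>. \<beta> \<bullet> coroot \<alpha> \<in> \<int>)"

definition reduced_roots :: "'a::euclidean_space set \<Rightarrow> bool" where
  "reduced_roots \<Phi> \<longleftrightarrow> (\<forall>\<alpha>\<in>\<Phi>. \<Phi> \<inter> span {\<alpha>} = {\<alpha>, - \<alpha>})"

text \<open>Simple roots are a family \<open>\<alpha> 1, \<dots>, \<alpha> n\<close>; the values of \<open>\<alpha>\<close> outside \<open>{1..n}\<close> are never used.\<close>

definition positive_roots :: "'a::euclidean_space set \<Rightarrow> nat \<Rightarrow> (nat \<Rightarrow> 'a) \<Rightarrow> 'a set" where
  "positive_roots \<Phi> n \<alpha> = {\<beta> \<in> \<Phi>. \<exists>c :: nat \<Rightarrow> nat. \<beta> = (\<Sum>i\<in>{1..n}. real (c i) *\<^sub>R \<alpha> i)}"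

definition base :: "'a::euclidean_space set \<Rightarrow> nat \<Rightarrow> (nat \<Rightarrow> 'a) \<Rightarrow> bool" where
  "base \<Phi> n \<alpha> \<longleftrightarrow>
     \<alpha> ` {1..n} \<subseteq> \<Phi> \<and> inj_on \<alpha> {1..n} \<and> independent (\<alpha> ` {1..n}) \<and>
     (\<forall>\<beta>\<in>\<Phi>. \<beta> \<in> positive_roots \<Phi> n \<alpha> \<or> - \<beta> \<in> positive_roots \<Phi> n \<alpha>)"

definition positive_roots_on ::
    "'a::euclidean_space set \<Rightarrow> nat \<Rightarrow> (nat \<Rightarrow> 'a) \<Rightarrow> nat set \<Rightarrow> 'a set" where
  "positive_roots_on \<Phi> n \<alpha> J = positive_roots \<Phi> n \<alpha> \<inter> span (\<alpha> ` J)"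


text \<open>The Weyl group is a set of bijections of the ambient space, with composition as product.\<close>

definition weyl_group :: "nat \<Rightarrow> (nat \<Rightarrow> 'a::euclidean_space) \<Rightarrow> ('a \<Rightarrow> 'a) set" where
  "weyl_group n \<alpha> = generate (BijGroup UNIV) ((\<lambda>i. reflection (\<alpha> i)) ` {1..n})"

text \<open>\<open>word_prod \<alpha> [i\<^sub>1, \<dots>, i\<^sub>k]\<close> is the product of simple reflections written in this order, so
  that the last letter acts first.\<close>

definition word_prod :: "(nat \<Rightarrow> 'a::euclidean_space) \<Rightarrow> nat list \<Rightarrow> 'a \<Rightarrow> 'a" where
  "word_prod \<alpha> is = foldr (\<lambda>i w. reflection (\<alpha> i) \<circ> w) is id"

definition weyl_length :: "nat \<Rightarrow> (nat \<Rightarrow> 'a::euclidean_space) \<Rightarrow> ('a \<Rightarrow> 'a) \<Rightarrow> nat" where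
  "weyl_length n \<alpha> w =
     (LEAST k. \<exists>is. set is \<subseteq> {1..n} \<and> length is = k \<and> word_prod \<alpha> is = w)"

definition reduced_word :: "nat \<Rightarrow> (nat \<Rightarrow> 'a::euclidean_space) \<Rightarrow> nat list \<Rightarrow> bool" where
  "reduced_word n \<alpha> is \<longleftrightarrow>
     set is \<subseteq> {1..n} \<and> length is = weyl_length n \<alpha> (word_prod \<alpha> is)"

definition inversions ::
    "'a::euclidean_space set \<Rightarrow> nat \<Rightarrow> (nat \<Rightarrow> 'a) \<Rightarrow> ('a \<Rightarrow> 'a) \<Rightarrow> 'a set" where
  "inversions \<Phi> n \<alpha> w = positive_roots \<Phi> n \<alpha> \<inter> w -` (uminus ` positive_roots \<Phi> n \<alpha>)"

text \<open>\<open>W\<^sup>J\<close>, defined through inversion sets: its elements are those that invert no positive root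
  of \<open>W\<^sub>J\<close>, which are the minimal length representatives of the cosets \<open>w W\<^sub>J\<close>.\<close>

definition min_coset_reps ::
    "'a::euclidean_space set \<Rightarrow> nat \<Rightarrow> (nat \<Rightarrow> 'a) \<Rightarrow> nat set \<Rightarrow> ('a \<Rightarrow> 'a) set" where
  "min_coset_reps \<Phi> n \<alpha> J =
     {w \<in> weyl_group n \<alpha>.
        inversions \<Phi> n \<alpha> w \<subseteq> positive_roots \<Phi> n \<alpha> - positive_roots_on \<Phi> n \<alpha> J}"


text \<open>A configuration in \<open>\<int>\<^sub>\<ge>\<^sub>0\<^sup>n\<close> is a function \<open>nat \<Rightarrow> nat\<close> that vanishes outside \<open>{1..n}\<close>; all
  configurations arising from \<open>\<lambda>_. 0\<close> by firing vertices in \<open>{1..n}\<close> have this property.\<close>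

definition neighbours :: "nat \<Rightarrow> (nat \<Rightarrow> 'a::euclidean_space) \<Rightarrow> nat \<Rightarrow> nat set" where
  "neighbours n \<alpha> v = {u \<in> {1..n}. u \<noteq> v \<and> \<alpha> u \<bullet> \<alpha> v \<noteq> 0}"

text \<open>\<open>edge_weight \<alpha> v u\<close> is \<open>n\<^sub>v\<^sub>,\<^sub>u\<close>. For neighbours in the Dynkin diagram of a crystallographic
  root system \<open>- (\<alpha> u \<bullet> coroot (\<alpha> v))\<close> is a positive integer, so the conversion is exact.\<close>

definition edge_weight :: "(nat \<Rightarrow> 'a::euclidean_space) \<Rightarrow> nat \<Rightarrow> nat \<Rightarrow> nat" where
  "edge_weight \<alpha> v u = nat \<lfloor>- (\<alpha> u \<bullet> coroot (\<alpha> v))\<rfloor>"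

definition neighbour_sum ::
    "nat \<Rightarrow> (nat \<Rightarrow> 'a::euclidean_space) \<Rightarrow> nat set \<Rightarrow> (nat \<Rightarrow> nat) \<Rightarrow> nat \<Rightarrow> nat" where
  "neighbour_sum n \<alpha> I c v =
     (\<Sum>u\<in>neighbours n \<alpha> v. edge_weight \<alpha> v u * c u) + (if v \<in> I then 1 else 0)"

definition sad ::
    "nat \<Rightarrow> (nat \<Rightarrow> 'a::euclidean_space) \<Rightarrow> nat set \<Rightarrow> (nat \<Rightarrow> nat) \<Rightarrow> nat \<Rightarrow> bool" where
  "sad n \<alpha> I c v \<longleftrightarrow> real (c v) < 1 / 2 * real (neighbour_sum n \<alpha> I c v)"

text \<open>Only sad vertices are fired, and for these the subtraction is not truncated.\<close>

definition fire ::
    "nat \<Rightarrow> (nat \<Rightarrow> 'a::euclidean_space) \<Rightarrow> nat set \<Rightarrow> nat \<Rightarrow> (nat \<Rightarrow> nat) \<Rightarrow> nat \<Rightarrow> nat" where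
  "fire n \<alpha> I v c = c(v := neighbour_sum n \<alpha> I c v - c v)"

primrec valid_from ::
    "nat \<Rightarrow> (nat \<Rightarrow> 'a::euclidean_space) \<Rightarrow> nat set \<Rightarrow> (nat \<Rightarrow> nat) \<Rightarrow> nat list \<Rightarrow> bool" where
  "valid_from n \<alpha> I c [] \<longleftrightarrow> True"
| "valid_from n \<alpha> I c (k # ks) \<longleftrightarrow>
     k \<in> {1..n} \<and> sad n \<alpha> I c k \<and> valid_from n \<alpha> I (fire n \<alpha> I k c) ks"

definition valid_firing_sequence ::
    "nat \<Rightarrow> (nat \<Rightarrow> 'a::euclidean_space) \<Rightarrow> nat set \<Rightarrow> nat list \<Rightarrow> bool" where
  "valid_firing_sequence n \<alpha> I ks \<longleftrightarrow> valid_from n \<alpha> I (\<lambda>_. 0) ks"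

definition config_after ::
    "nat \<Rightarrow> (nat \<Rightarrow> 'a::euclidean_space) \<Rightarrow> nat set \<Rightarrow> nat list \<Rightarrow> nat \<Rightarrow> nat" where
  "config_after n \<alpha> I ks = fold (fire n \<alpha> I) ks (\<lambda>_. 0)"

definition reachable_configs ::
    "nat \<Rightarrow> (nat \<Rightarrow> 'a::euclidean_space) \<Rightarrow> nat set \<Rightarrow> (nat \<Rightarrow> nat) set" where
  "reachable_configs n \<alpha> I = {config_after n \<alpha> I ks | ks. valid_firing_sequence n \<alpha> I ks}"

end

theory Submission
  imports Defs
begin

text \<open>Pick \<open>\<omega>\<close> with \<open>\<omega> \<bullet> coroot (\<alpha> i) = \<epsilon>\<^sub>i\<close> and attach to a configuration \<open>c\<close> the vector
  \<open>\<omega> - (\<Sum>u. c u *\<^sub>R \<alpha> u)\<close>. A vertex \<open>v\<close> is sad iff this vector has positive inner product with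
  \<open>\<alpha> v\<close>, and firing \<open>v\<close> reflects the vector in \<open>\<alpha> v\<close>; hence a valid firing sequence reaching
  \<open>w\<close> leads to the vector \<open>w \<omega>\<close>. As \<open>\<omega>\<close> is dominant and orthogonal exactly to the positive roots
  in \<open>\<Phi>\<^sub>J\<close>, for \<open>w \<in> W\<^sup>J\<close> the condition \<open>w \<omega> \<bullet> \<alpha> k > 0\<close> says that \<open>w\<inverse> (\<alpha> k)\<close> is a positive
  root outside \<open>\<Phi>\<^sub>J\<close>, which by the exchange property means that \<open>s\<^sub>k w\<close> is longer than \<open>w\<close> and
  still lies in \<open>W\<^sup>J\<close>.\<close>

section \<open>Reflections and words\<close>

lemma linear_reflection: "linear (reflection a)"
  by (rule linearI) (simp_all add: reflection_def inner_add_left algebra_simps)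

lemma inner_coroot: "x \<bullet> coroot a = 2 * (x \<bullet> a) / (a \<bullet> a)"
  by (simp add: coroot_def)

lemma inner_coroot_self: "a \<noteq> 0 \<Longrightarrow> a \<bullet> coroot a = 2"
  by (simp add: inner_coroot)

lemma inner_coroot_pos_iff: "a \<noteq> 0 \<Longrightarrow> x \<bullet> coroot a > 0 \<longleftrightarrow> x \<bullet> a > 0"
  by (auto simp: inner_coroot zero_less_divide_iff dest: less_le_trans[OF _ inner_ge_zero])

lemma reflection_self: "reflection a a = - a"
  by (cases "a = 0") (simp_all add: reflection_def inner_coroot scaleR_2)

lemma reflection_inner_left: "reflection a x \<bullet> y = x \<bullet> reflection a y"
  by (simp add: reflection_def inner_coroot inner_diff_left inner_diff_right inner_commute)

lemma reflection_reflection [simp]: "reflection a (reflection a x) = x"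
proof -
  have "reflection a (reflection a x) = reflection a x - (x \<bullet> coroot a) *\<^sub>R reflection a a"
    using linear_reflection[of a]
    by (metis linear_diff linear_scale reflection_def)
  then show ?thesis
    by (simp add: reflection_self reflection_def)
qed

text \<open>Reflections are isometries, so conjugating one by another yields the reflection in the
  image root. This lets a reflection move past a letter in \<open>exchange\<close>.\<close>

lemma reflection_conjugate:
  "reflection (reflection a b) (reflection a x) = reflection a (reflection b x)"
proof -
  have "reflection a x \<bullet> coroot (reflection a b) = x \<bullet> coroot b"
    by (simp add: inner_coroot reflection_inner_left)
  then show ?thesis
    using linear_reflection[of a]
    by (simp add: linear_diff linear_scale reflection_def[of "reflection a b"] reflection_def[of b])
qed

lemma word_prod_Nil [simp]: "word_prod \<alpha> [] = id"
  by (simp add: word_prod_def)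

lemma word_prod_Cons [simp]: "word_prod \<alpha> (i # is) = reflection (\<alpha> i) \<circ> word_prod \<alpha> is"
  by (simp add: word_prod_def)

lemma word_prod_append [simp]: "word_prod \<alpha> (is @ js) = word_prod \<alpha> is \<circ> word_prod \<alpha> js"
  by (induction "is") auto

lemma linear_word_prod: "linear (word_prod \<alpha> is)"
proof (induction "is")
  case Nil
  show ?case unfolding word_prod_Nil by (rule linear_id)
next
  case (Cons i "is")
  then show ?case unfolding word_prod_Cons by (intro linear_compose linear_reflection)
qed

lemma word_prod_minus: "word_prod \<alpha> is (- x) = - word_prod \<alpha> is x"
  by (rule linear_neg[OF linear_word_prod])

lemma word_prod_rev_cancel [simp]: "word_prod \<alpha> (rev is) (word_prod \<alpha> is x) = x"
  by (induction "is" arbitrary: x) auto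

lemma word_prod_cancel_rev [simp]: "word_prod \<alpha> is (word_prod \<alpha> (rev is) x) = x"
  using word_prod_rev_cancel[of \<alpha> "rev is"] by simp

text \<open>Each letter is self-adjoint, so the adjoint of a product is the product of the reversed
  word, which is also its inverse.\<close>

lemma word_prod_inner_left: "word_prod \<alpha> is x \<bullet> y = x \<bullet> word_prod \<alpha> (rev is) y"
  by (induction "is" arbitrary: y) (auto simp: reflection_inner_left)

section \<open>The Weyl group as the set of products of words\<close>

lemma bij_reflection: "bij (reflection a)"
  by (rule involuntory_imp_bij) simp

lemma mult_BijGroup_UNIV: "bij f \<Longrightarrow> bij g \<Longrightarrow> f \<otimes>\<^bsub>BijGroup UNIV\<^esub> g = f \<circ> g"
  by (auto simp: BijGroup_def Bij_def compose_def)

lemma one_BijGroup_UNIV: "\<one>\<^bsub>BijGroup UNIV\<^esub> = id"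
  by (auto simp: BijGroup_def)

lemma carrier_BijGroup_UNIV: "carrier (BijGroup UNIV) = {f. bij f}"
  by (auto simp: BijGroup_def Bij_def)

lemma inv_BijGroup_reflection: "inv\<^bsub>BijGroup UNIV\<^esub> (reflection a) = reflection a"
proof (rule group.inv_equality[OF group_BijGroup])
  show "reflection a \<otimes>\<^bsub>BijGroup UNIV\<^esub> reflection a = \<one>\<^bsub>BijGroup UNIV\<^esub>"
    by (simp add: mult_BijGroup_UNIV one_BijGroup_UNIV bij_reflection fun_eq_iff)
qed (simp_all add: carrier_BijGroup_UNIV bij_reflection)

lemma bij_word_prod: "bij (word_prod \<alpha> is)"
proof (induction "is")
  case Nil
  show ?case unfolding word_prod_Nil by (rule bij_id)
next
  case (Cons i "is")
  then show ?case unfolding word_prod_Cons by (intro bij_comp bij_reflection)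
qed

text \<open>The generators are involutions, so the inverses allowed by \<open>generate\<close>
  contribute no new letters.\<close>

lemma weyl_group_eq_words: "weyl_group n \<alpha> = word_prod \<alpha> ` {is. set is \<subseteq> {1..n}}"
proof (intro equalityI subsetI)
  fix w assume "w \<in> weyl_group n \<alpha>"
  then show "w \<in> word_prod \<alpha> ` {is. set is \<subseteq> {1..n}}"
    unfolding weyl_group_def
  proof (induction rule: generate.induct)
    case one
    show ?case by (rule image_eqI[of _ _ "[]"]) (simp_all add: one_BijGroup_UNIV)
  next
    case (incl h)
    then obtain i where "i \<in> {1..n}" "h = reflection (\<alpha> i)" by blast
    then show ?case by (intro image_eqI[of _ _ "[i]"]) simp_all
  next
    case (inv h)
    then obtain i where "i \<in> {1..n}" "h = reflection (\<alpha> i)" by blast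
    then show ?case by (intro image_eqI[of _ _ "[i]"]) (simp_all add: inv_BijGroup_reflection)
  next
    case (eng h1 h2)
    then obtain is1 is2 where
      "set is1 \<subseteq> {1..n}" "h1 = word_prod \<alpha> is1" "set is2 \<subseteq> {1..n}" "h2 = word_prod \<alpha> is2"
      by blast
    then show ?case
      by (intro image_eqI[of _ _ "is1 @ is2"]) (simp_all add: mult_BijGroup_UNIV bij_word_prod)
  qed
next
  fix w assume "w \<in> word_prod \<alpha> ` {is. set is \<subseteq> {1..n}}"
  then obtain "is" where w: "w = word_prod \<alpha> is" and "set is \<subseteq> {1..n}" by blast
  then have "word_prod \<alpha> is \<in> weyl_group n \<alpha>"
  proof (induction "is" arbitrary: w)
    case Nil
    show ?case
      unfolding weyl_group_def word_prod_Nil one_BijGroup_UNIV[symmetric] by (rule generate.one)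
  next
    case (Cons i "is")
    then have "word_prod \<alpha> is \<in> weyl_group n \<alpha>" "i \<in> {1..n}" by simp_all
    then have "reflection (\<alpha> i) \<otimes>\<^bsub>BijGroup UNIV\<^esub> word_prod \<alpha> is \<in> weyl_group n \<alpha>"
      unfolding weyl_group_def by (blast intro: generate.eng generate.incl)
    then show ?case
      by (simp only: mult_BijGroup_UNIV bij_reflection bij_word_prod word_prod_Cons)
  qed
  with w show "w \<in> weyl_group n \<alpha>" by simp
qed

text \<open>Unfolds the \<open>LEAST\<close> in the length function into a comparison with all words
  for the same element.\<close>

lemma reduced_word_iff:
  "reduced_word n \<alpha> is \<longleftrightarrow> set is \<subseteq> {1..n} \<and>
     (\<forall>js. set js \<subseteq> {1..n} \<and> word_prod \<alpha> js = word_prod \<alpha> is \<longrightarrow> length is \<le> length js)"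
    (is "_ \<longleftrightarrow> _ \<and> ?min")
proof -
  let ?P = "\<lambda>k. \<exists>js. set js \<subseteq> {1..n} \<and> length js = k \<and> word_prod \<alpha> js = word_prod \<alpha> is"
  have "length is = (LEAST k. ?P k) \<longleftrightarrow> ?min" if "set is \<subseteq> {1..n}"
  proof
    assume "length is = (LEAST k. ?P k)"
    then show ?min by (metis (mono_tags, lifting) Least_le)
  next
    assume ?min
    with that have "(LEAST k. ?P k) = length is" by (intro Least_equality) auto
    then show "length is = (LEAST k. ?P k)" by simp
  qed
  then show ?thesis
    by (auto simp: reduced_word_def weyl_length_def)
qed

lemma reduced_word_subset: "reduced_word n \<alpha> is \<Longrightarrow> set is \<subseteq> {1..n}"
  by (simp add: reduced_word_def)

lemma weyl_group_reduced_word: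
  assumes "w \<in> weyl_group n \<alpha>"
  obtains "is" where "reduced_word n \<alpha> is" "word_prod \<alpha> is = w"
proof -
  let ?P = "\<lambda>is. set is \<subseteq> {1..n} \<and> word_prod \<alpha> is = w"
  obtain js where "?P js"
    using assms by (auto simp: weyl_group_eq_words)
  then have "?P (arg_min length ?P)" "\<forall>ks. ?P ks \<longrightarrow> length (arg_min length ?P) \<le> length ks"
    using arg_min_nat_lemma[of ?P js length] by blast+
  then show thesis
    by (intro that[of "arg_min length ?P"]) (auto simp: reduced_word_iff)
qed

section \<open>Positive roots and the exchange property\<close>

locale simple_system =
  fixes \<Phi> :: "'a::euclidean_space set" and n :: nat and \<alpha> :: "nat \<Rightarrow> 'a"
  assumes root_system: "root_system \<Phi>"
    and crystallographic: "crystallographic \<Phi>"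
    and reduced: "reduced_roots \<Phi>"
    and base: "base \<Phi> n \<alpha>"
begin

abbreviation "pos \<equiv> positive_roots \<Phi> n \<alpha>"

lemma pos_root: "\<beta> \<in> pos \<Longrightarrow> \<beta> \<in> \<Phi>"
  by (simp add: positive_roots_def)

lemma root_nonzero: "\<beta> \<in> \<Phi> \<Longrightarrow> \<beta> \<noteq> 0"
  using root_system by (auto simp: root_system_def)

lemma root_reflection: "\<beta> \<in> \<Phi> \<Longrightarrow> \<gamma> \<in> \<Phi> \<Longrightarrow> reflection \<beta> \<gamma> \<in> \<Phi>"
  using root_system by (auto simp: root_system_def)

lemma root_cases: "\<beta> \<in> \<Phi> \<Longrightarrow> \<beta> \<in> pos \<or> - \<beta> \<in> pos"
  using base by (auto simp: base_def)

lemma simple_root: "i \<in> {1..n} \<Longrightarrow> \<alpha> i \<in> \<Phi>"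
  using base by (auto simp: base_def)

lemma simple_nonzero: "i \<in> {1..n} \<Longrightarrow> \<alpha> i \<noteq> 0"
  using simple_root root_nonzero by blast

lemma simple_pos:
  assumes "i \<in> {1..n}" shows "\<alpha> i \<in> pos"
proof -
  have "\<alpha> i = (\<Sum>j\<in>{1..n}. real ((\<lambda>j. if j = i then 1 else 0) j) *\<^sub>R \<alpha> j)"
    using assms by (simp add: if_distrib[of real] if_distrib[of "\<lambda>x. x *\<^sub>R _"] sum.delta cong: if_cong)
  with simple_root[OF assms] show ?thesis
    unfolding positive_roots_def by (intro CollectI conjI exI)
qed

section \<open>Coefficients with respect to the simple roots\<close>

lemma simple_inj: "inj_on \<alpha> {1..n}" and simple_independent: "independent (\<alpha> ` {1..n})"
  using base by (auto simp: base_def)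

lemma simple_coeff_zero:
  assumes "(\<Sum>j\<in>{1..n}. x j *\<^sub>R \<alpha> j) = 0" "i \<in> {1..n}"
  shows "x i = 0"
proof -
  \<comment> \<open>Independence concerns the set of simple roots; injectivity of the family lets
    \<open>?y\<close> carry coefficients from indices over to vectors.\<close>
  let ?y = "\<lambda>v. x (the_inv_into {1..n} \<alpha> v)"
  have "(\<Sum>v\<in>\<alpha> ` {1..n}. ?y v *\<^sub>R v) = (\<Sum>j\<in>{1..n}. x j *\<^sub>R \<alpha> j)"
    using simple_inj by (simp add: sum.reindex the_inv_into_f_f)
  with assms have "(\<Sum>v\<in>\<alpha> ` {1..n}. ?y v *\<^sub>R v) = 0" by simp
  then have "?y (\<alpha> i) = 0"
    using simple_independent assms(2) independentD[of "\<alpha> ` {1..n}" "\<alpha> ` {1..n}" ?y "\<alpha> i"] by auto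
  then show ?thesis
    using assms(2) simple_inj by (simp add: the_inv_into_f_f)
qed

lemma simple_coeff_eq:
  assumes "(\<Sum>j\<in>{1..n}. x j *\<^sub>R \<alpha> j) = (\<Sum>j\<in>{1..n}. y j *\<^sub>R \<alpha> j)" "i \<in> {1..n}"
  shows "x i = y i"
  using simple_coeff_zero[of "\<lambda>j. x j - y j" i] assms
  by (simp add: scaleR_left_diff_distrib sum_subtractf)

lemma pos_coeff_nonneg:
  assumes "\<beta> \<in> pos" "\<beta> = (\<Sum>j\<in>{1..n}. x j *\<^sub>R \<alpha> j)" "i \<in> {1..n}"
  shows "x i \<ge> 0"
proof -
  obtain c :: "nat \<Rightarrow> nat" where "\<beta> = (\<Sum>j\<in>{1..n}. real (c j) *\<^sub>R \<alpha> j)"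
    using assms(1) by (auto simp: positive_roots_def)
  then have "(\<Sum>j\<in>{1..n}. x j *\<^sub>R \<alpha> j) = (\<Sum>j\<in>{1..n}. real (c j) *\<^sub>R \<alpha> j)"
    using assms(2) by argo
  then have "x i = real (c i)" using assms(3) by (rule simple_coeff_eq)
  then show ?thesis by simp
qed

text \<open>The coefficients of a root all have the same sign, so a single positive one
  decides.\<close>

lemma pos_if_coeff_pos:
  assumes "\<beta> \<in> \<Phi>" "\<beta> = (\<Sum>j\<in>{1..n}. x j *\<^sub>R \<alpha> j)" "i \<in> {1..n}" "x i > 0"
  shows "\<beta> \<in> pos"
proof (rule ccontr)
  assume "\<beta> \<notin> pos"
  then have "- \<beta> \<in> pos" using root_cases assms(1) by blast
  moreover have "- \<beta> = (\<Sum>j\<in>{1..n}. (- x j) *\<^sub>R \<alpha> j)"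
    using assms(2) by (simp add: sum_negf)
  ultimately have "- x i \<ge> 0"
    using pos_coeff_nonneg[of "- \<beta>" "\<lambda>j. - x j"] assms(3) by simp
  with assms(4) show False by simp
qed

lemma not_pos_and_neg: "\<beta> \<in> pos \<Longrightarrow> - \<beta> \<notin> pos"
proof
  assume \<beta>: "\<beta> \<in> pos" "- \<beta> \<in> pos"
  then obtain c :: "nat \<Rightarrow> nat" where c: "\<beta> = (\<Sum>j\<in>{1..n}. real (c j) *\<^sub>R \<alpha> j)"
    by (auto simp: positive_roots_def)
  then have "- \<beta> = (\<Sum>j\<in>{1..n}. (- real (c j)) *\<^sub>R \<alpha> j)"
    by (simp add: sum_negf)
  then have "c i = 0" if "i \<in> {1..n}" for i
    using pos_coeff_nonneg[OF \<beta>(2), of "\<lambda>j. - real (c j)"] that by fastforce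
  then have "\<beta> = 0" using c by simp
  then show False using root_nonzero pos_root \<beta> by blast
qed

lemma reflection_simple_expansion:
  assumes "\<beta> = (\<Sum>j\<in>{1..n}. x j *\<^sub>R \<alpha> j)" "i \<in> {1..n}"
  shows "reflection (\<alpha> i) \<beta> = (\<Sum>j\<in>{1..n}. (x j - (if j = i then \<beta> \<bullet> coroot (\<alpha> i) else 0)) *\<^sub>R \<alpha> j)"
proof -
  have "(\<Sum>j\<in>{1..n}. (if j = i then \<beta> \<bullet> coroot (\<alpha> i) else 0) *\<^sub>R \<alpha> j) = (\<beta> \<bullet> coroot (\<alpha> i)) *\<^sub>R \<alpha> i"
    using assms(2) by (simp add: if_distrib[of "\<lambda>x. x *\<^sub>R _"] sum.delta cong: if_cong)
  then show ?thesis
    by (simp only: scaleR_left_diff_distrib sum_subtractf reflection_def assms(1)[symmetric])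
qed

text \<open>Since the root system is reduced, \<beta> is no multiple of \<open>\<alpha> i\<close>,
  so some other simple root occurs in it with a positive coefficient. The reflection leaves that
  coefficient unchanged.\<close>

lemma reflection_simple_pos:
  assumes "\<beta> \<in> pos" "i \<in> {1..n}" "\<beta> \<noteq> \<alpha> i"
  shows "reflection (\<alpha> i) \<beta> \<in> pos"
proof -
  obtain c :: "nat \<Rightarrow> nat" where c: "\<beta> = (\<Sum>j\<in>{1..n}. real (c j) *\<^sub>R \<alpha> j)"
    using assms by (auto simp: positive_roots_def)
  have "\<exists>j\<in>{1..n}. j \<noteq> i \<and> c j > 0"
  proof (rule ccontr)
    assume "\<not> ?thesis"
    then have "\<beta> = (\<Sum>j\<in>{1..n}. (if j = i then real (c j) else 0) *\<^sub>R \<alpha> j)"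
      unfolding c by (intro sum.cong) auto
    also have "\<dots> = real (c i) *\<^sub>R \<alpha> i"
      using assms(2) by (simp add: if_distrib[of "\<lambda>x. x *\<^sub>R _"] sum.delta cong: if_cong)
    finally have "\<beta> \<in> \<Phi> \<inter> span {\<alpha> i}"
      using assms(1) pos_root by (auto simp: span_base span_scale)
    then have "\<beta> = - \<alpha> i"
      using reduced simple_root[OF assms(2)] assms(3) by (auto simp: reduced_roots_def)
    then show False using assms not_pos_and_neg simple_pos by blast
  qed
  then obtain j where "j \<in> {1..n}" "j \<noteq> i" "c j > 0" by blast
  moreover have "reflection (\<alpha> i) \<beta> \<in> \<Phi>"
    using assms root_reflection simple_root pos_root by blast
  ultimately show ?thesis
    by (intro pos_if_coeff_pos[OF _ reflection_simple_expansion[OF c assms(2)], of j]) auto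
qed

text \<open>The reflection in \<open>\<alpha> j\<close> keeps \<open>\<alpha> i\<close> positive,
  and the coefficient of \<open>\<alpha> j\<close> in the result is minus the pairing in
  question.\<close>

lemma simple_inner_coroot_nonpos:
  assumes "i \<in> {1..n}" "j \<in> {1..n}" "i \<noteq> j"
  shows "\<alpha> i \<bullet> coroot (\<alpha> j) \<le> 0"
proof -
  have exp: "\<alpha> i = (\<Sum>k\<in>{1..n}. (if k = i then 1 else 0) *\<^sub>R \<alpha> k)"
    using assms by (simp add: if_distrib[of "\<lambda>x. x *\<^sub>R _"] sum.delta cong: if_cong)
  have "\<alpha> i \<noteq> \<alpha> j"
    using assms simple_inj by (auto dest: inj_onD)
  then have "reflection (\<alpha> j) (\<alpha> i) \<in> pos"
    using assms by (intro reflection_simple_pos simple_pos)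
  from pos_coeff_nonneg[OF this reflection_simple_expansion[OF exp assms(2)] assms(2)]
  show ?thesis using assms(3) by simp
qed

section \<open>Exchange property and length\<close>

lemma root_word_prod: "set is \<subseteq> {1..n} \<Longrightarrow> \<beta> \<in> \<Phi> \<Longrightarrow> word_prod \<alpha> is \<beta> \<in> \<Phi>"
  by (induction "is") (simp_all add: root_reflection simple_root)

text \<open>If the inverse of w makes the positive root \<beta> negative, then multiplying w on the
  left by the reflection in \<beta> deletes a letter. The letters are scanned from the left: if
  \<beta> is the simple root of the first letter, that letter cancels; otherwise its reflection
  keeps \<beta> positive and the search continues with the reflected root.\<close>

lemma exchange:
  assumes "set is \<subseteq> {1..n}" "\<beta> \<in> pos" "- word_prod \<alpha> (rev is) \<beta> \<in> pos"
  shows "\<exists>js. set js \<subseteq> {1..n} \<and> length is = Suc (length js) \<and>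
           word_prod \<alpha> js = reflection \<beta> \<circ> word_prod \<alpha> is"
  using assms
proof (induction "is" arbitrary: \<beta>)
  case Nil
  then show ?case using not_pos_and_neg by auto
next
  case (Cons i "is")
  show ?case
  proof (cases "\<beta> = \<alpha> i")
    case True
    then have "word_prod \<alpha> is = reflection \<beta> \<circ> word_prod \<alpha> (i # is)"
      by auto
    then show ?thesis using Cons.prems by (intro exI[of _ "is"]) (simp del: word_prod_Cons)
  next
    case False
    then have "reflection (\<alpha> i) \<beta> \<in> pos"
      using Cons.prems by (intro reflection_simple_pos) auto
    moreover have "set is \<subseteq> {1..n}" "- word_prod \<alpha> (rev is) (reflection (\<alpha> i) \<beta>) \<in> pos"
      using Cons.prems by simp_all
    ultimately obtain js where js: "set js \<subseteq> {1..n}" "length is = Suc (length js)"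
        "word_prod \<alpha> js = reflection (reflection (\<alpha> i) \<beta>) \<circ> word_prod \<alpha> is"
      using Cons.IH by blast
    have "word_prod \<alpha> (i # js) = reflection \<beta> \<circ> word_prod \<alpha> (i # is)"
      using reflection_conjugate[of "\<alpha> i" "reflection (\<alpha> i) \<beta>"] by (auto simp: js(3))
    then show ?thesis using js Cons.prems by (intro exI[of _ "i # js"]) auto
  qed
qed

text \<open>As \<open>rev is\<close> represents the inverse of w, this is the criterion that s_k w
  is longer than w iff the inverse of w keeps \<open>\<alpha> k\<close> positive.\<close>

lemma reduced_word_Cons_iff:
  "reduced_word n \<alpha> (k # is) \<longleftrightarrow>
     k \<in> {1..n} \<and> reduced_word n \<alpha> is \<and> word_prod \<alpha> (rev is) (\<alpha> k) \<in> pos"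
proof (intro iffI conjI)
  assume red: "reduced_word n \<alpha> (k # is)"
  then show k: "k \<in> {1..n}" by (simp add: reduced_word_iff)
  have "is": "set is \<subseteq> {1..n}" using red by (simp add: reduced_word_iff)
  have short: "Suc (length is) \<le> length js"
    if "set js \<subseteq> {1..n}" "word_prod \<alpha> js = reflection (\<alpha> k) \<circ> word_prod \<alpha> is" for js
    using red that by (simp add: reduced_word_iff)
  have "length is \<le> length js"
    if "set js \<subseteq> {1..n}" "word_prod \<alpha> js = word_prod \<alpha> is" for js
    using short[of "k # js"] k that by simp
  with "is" show "reduced_word n \<alpha> is" by (simp add: reduced_word_iff)
  show "word_prod \<alpha> (rev is) (\<alpha> k) \<in> pos"
  proof (rule ccontr)
    \<comment> \<open>Exchange would then give a word for s_k w with one letter fewer than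
      \<open>is\<close>, contradicting \<open>short\<close>.\<close>
    assume "word_prod \<alpha> (rev is) (\<alpha> k) \<notin> pos"
    then have "- word_prod \<alpha> (rev is) (\<alpha> k) \<in> pos"
      using root_cases[OF root_word_prod[of "rev is" "\<alpha> k"]] simple_root[OF k] "is" by simp
    then obtain js where "set js \<subseteq> {1..n}" "length is = Suc (length js)"
        "word_prod \<alpha> js = reflection (\<alpha> k) \<circ> word_prod \<alpha> is"
      using exchange "is" simple_pos[OF k] by blast
    with short[of js] show False by simp
  qed
next
  assume *: "k \<in> {1..n} \<and> reduced_word n \<alpha> is \<and> word_prod \<alpha> (rev is) (\<alpha> k) \<in> pos"
  then have k: "k \<in> {1..n}" and "is": "set is \<subseteq> {1..n}" by (simp_all add: reduced_word_iff)
  have "Suc (length is) \<le> length js"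
    if js: "set js \<subseteq> {1..n}" "word_prod \<alpha> js = reflection (\<alpha> k) \<circ> word_prod \<alpha> is" for js
  proof -
    \<comment> \<open>Hence exchange applies to any word \<open>js\<close> for s_k w. It removes one
      letter and yields a word for w, which has at least \<open>length is\<close> letters.\<close>
    have "word_prod \<alpha> (rev js) (\<alpha> k) = - word_prod \<alpha> (rev is) (\<alpha> k)"
    proof -
      have "word_prod \<alpha> js (word_prod \<alpha> (rev is) (\<alpha> k)) = - \<alpha> k"
        by (simp add: js(2) reflection_self)
      then show ?thesis
        by (metis word_prod_rev_cancel word_prod_minus minus_minus)
    qed
    with * have "- word_prod \<alpha> (rev js) (\<alpha> k) \<in> pos" by simp
    then obtain ks where ks: "set ks \<subseteq> {1..n}" "length js = Suc (length ks)"
        "word_prod \<alpha> ks = reflection (\<alpha> k) \<circ> word_prod \<alpha> js"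
      using exchange js(1) simple_pos[OF k] by blast
    then have "word_prod \<alpha> ks = word_prod \<alpha> is" by (auto simp: js(2))
    then show ?thesis using * ks by (simp add: reduced_word_iff)
  qed
  with k "is" show "reduced_word n \<alpha> (k # is)"
    by (simp add: reduced_word_iff)
qed

end

section \<open>Configurations as translates of a dominant vector\<close>

text \<open>The vector \<omega> is fixed only up to the orthogonal complement of the simple roots;
  the sum of the fundamental weights with index in \<open>I\<close> is one choice.\<close>

locale kostant_game = simple_system \<Phi> n \<alpha>
  for \<Phi> :: "'a::euclidean_space set" and n :: nat and \<alpha> :: "nat \<Rightarrow> 'a" +
  fixes I :: "nat set" and \<omega> :: 'a
  assumes active_subset: "I \<subseteq> {1..n}"
    and weight_coroot: "i \<in> {1..n} \<Longrightarrow> \<omega> \<bullet> coroot (\<alpha> i) = (if i \<in> I then 1 else 0)"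
begin

abbreviation "reps \<equiv> min_coset_reps \<Phi> n \<alpha> ({1..n} - I)"

definition config_weight :: "(nat \<Rightarrow> nat) \<Rightarrow> 'a" where
  "config_weight c = \<omega> - (\<Sum>u\<in>{1..n}. real (c u) *\<^sub>R \<alpha> u)"

section \<open>Pairing of positive roots with the dominant vector\<close>

lemma simple_inner_weight:
  assumes "i \<in> {1..n}"
  shows "i \<in> I \<Longrightarrow> \<alpha> i \<bullet> \<omega> > 0" "i \<notin> I \<Longrightarrow> \<alpha> i \<bullet> \<omega> = 0"
proof -
  assume "i \<in> I"
  then have "\<omega> \<bullet> \<alpha> i > 0"
    using weight_coroot[OF assms] inner_coroot_pos_iff[OF simple_nonzero[OF assms], of \<omega>] by simp
  then show "\<alpha> i \<bullet> \<omega> > 0" by (simp only: inner_commute)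
next
  assume "i \<notin> I"
  then have "\<omega> \<bullet> \<alpha> i = 0"
    using weight_coroot[OF assms] simple_nonzero[OF assms] by (simp add: inner_coroot)
  then show "\<alpha> i \<bullet> \<omega> = 0" by (simp only: inner_commute)
qed

lemma pos_inner_weight_nonneg:
  assumes "\<beta> \<in> pos"
  shows "\<beta> \<bullet> \<omega> \<ge> 0"
proof -
  obtain c :: "nat \<Rightarrow> nat" where "\<beta> = (\<Sum>j\<in>{1..n}. real (c j) *\<^sub>R \<alpha> j)"
    using assms by (auto simp: positive_roots_def)
  moreover have "\<alpha> j \<bullet> \<omega> \<ge> 0" if "j \<in> {1..n}" for j
    using simple_inner_weight[OF that] by fastforce
  ultimately show ?thesis
    by (auto simp: inner_sum_left intro!: sum_nonneg)
qed

text \<open>The pairing is a sum of nonnegative terms, so it vanishes only if no active simple root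
  occurs in \<beta>.\<close>

lemma pos_inner_weight_zero_iff:
  assumes "\<beta> \<in> pos"
  shows "\<beta> \<bullet> \<omega> = 0 \<longleftrightarrow> \<beta> \<in> span (\<alpha> ` ({1..n} - I))"
proof
  assume zero: "\<beta> \<bullet> \<omega> = 0"
  obtain c :: "nat \<Rightarrow> nat" where c: "\<beta> = (\<Sum>j\<in>{1..n}. real (c j) *\<^sub>R \<alpha> j)"
    using assms by (auto simp: positive_roots_def)
  have nonneg: "real (c j) * (\<alpha> j \<bullet> \<omega>) \<ge> 0" if "j \<in> {1..n}" for j
    using pos_inner_weight_nonneg[OF simple_pos[OF that]] by simp
  have "(\<Sum>j\<in>{1..n}. real (c j) * (\<alpha> j \<bullet> \<omega>)) = 0"
    using zero by (simp add: c inner_sum_left)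
  then have "real (c j) * (\<alpha> j \<bullet> \<omega>) = 0" if "j \<in> {1..n}" for j
    using nonneg that sum_nonneg_eq_0_iff[of "{1..n}" "\<lambda>j. real (c j) * (\<alpha> j \<bullet> \<omega>)"] by blast
  then have "c j = 0" if "j \<in> I" for j
    using that active_subset simple_inner_weight(1)[of j] by fastforce
  then show "\<beta> \<in> span (\<alpha> ` ({1..n} - I))"
    unfolding c by (intro span_sum) (metis DiffI imageI of_nat_0 scaleR_zero_left span_base span_scale span_zero)
next
  assume "\<beta> \<in> span (\<alpha> ` ({1..n} - I))"
  then show "\<beta> \<bullet> \<omega> = 0"
    by (induction rule: span_induct_alt) (auto simp: inner_add_left simple_inner_weight(2))
qed

section \<open>Inversions and minimal coset representatives\<close>

lemma word_in_reps_iff: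
  assumes "set is \<subseteq> {1..n}"
  shows "word_prod \<alpha> is \<in> reps \<longleftrightarrow> (\<forall>\<beta>\<in>pos. - word_prod \<alpha> is \<beta> \<in> pos \<longrightarrow> \<beta> \<bullet> \<omega> > 0)"
proof -
  have "word_prod \<alpha> is \<in> reps \<longleftrightarrow>
      (\<forall>\<beta>\<in>pos. - word_prod \<alpha> is \<beta> \<in> pos \<longrightarrow> \<beta> \<notin> span (\<alpha> ` ({1..n} - I)))"
    using assms
    by (auto simp: min_coset_reps_def weyl_group_eq_words inversions_def positive_roots_on_def
        image_iff subset_iff) (metis minus_minus)+
  \<comment> \<open>On positive roots the pairing with \<omega> is nonnegative, so lying outside the
    span means pairing strictly positively.\<close>
  then show ?thesis
    using pos_inner_weight_zero_iff pos_inner_weight_nonneg by (metis less_eq_real_def order_less_irrefl)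
qed

text \<open>When s_k w is longer than w, it has exactly one further inversion, the image of
  \<open>\<alpha> k\<close> under the inverse of w. Moving w across the inner product turns the
  condition on this root into one on w \<omega>.\<close>

lemma reps_Cons_iff:
  assumes "k \<in> {1..n}" "set is \<subseteq> {1..n}" "word_prod \<alpha> (rev is) (\<alpha> k) \<in> pos"
  shows "word_prod \<alpha> (k # is) \<in> reps \<longleftrightarrow>
           word_prod \<alpha> is \<in> reps \<and> word_prod \<alpha> is \<omega> \<bullet> \<alpha> k > 0"
proof -
  let ?\<gamma> = "word_prod \<alpha> (rev is) (\<alpha> k)"
  have "- word_prod \<alpha> (k # is) \<beta> \<in> pos \<longleftrightarrow> \<beta> = ?\<gamma> \<or> - word_prod \<alpha> is \<beta> \<in> pos" if "\<beta> \<in> pos" for \<beta>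
  proof (cases "\<beta> = ?\<gamma>")
    case True
    then show ?thesis using simple_pos[OF assms(1)] by (simp add: reflection_self)
  next
    case False
    let ?\<delta> = "word_prod \<alpha> is \<beta>"
    have root: "?\<delta> \<in> \<Phi>" using root_word_prod assms(2) that pos_root by blast
    have ne: "?\<delta> \<noteq> \<alpha> k" using False by (metis word_prod_rev_cancel)
    have ne': "- ?\<delta> \<noteq> \<alpha> k"
    proof
      assume "- ?\<delta> = \<alpha> k"
      then have "?\<gamma> = - \<beta>" by (metis word_prod_minus word_prod_rev_cancel)
      with assms(3) that show False using not_pos_and_neg by simp
    qed
    \<comment> \<open>Being neither \<open>\<alpha> k\<close> nor its negative,
      \<open>?\<delta>\<close> keeps its sign under the reflection in
      \<open>\<alpha> k\<close>.\<close>
    have "- reflection (\<alpha> k) ?\<delta> = reflection (\<alpha> k) (- ?\<delta>)"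
      by (simp add: linear_neg linear_reflection)
    then show ?thesis
      using False root_cases[OF root] reflection_simple_pos[OF _ assms(1)] ne ne' not_pos_and_neg
      by (metis comp_apply word_prod_Cons)
  qed
  then have "word_prod \<alpha> (k # is) \<in> reps \<longleftrightarrow> word_prod \<alpha> is \<in> reps \<and> ?\<gamma> \<bullet> \<omega> > 0"
    using assms word_in_reps_iff[of "k # is"] word_in_reps_iff[of "is"] by auto
  then show ?thesis
    by (simp add: word_prod_inner_left inner_commute[of \<omega>])
qed

abbreviation "reduced_rep is \<equiv> reduced_word n \<alpha> is \<and> word_prod \<alpha> is \<in> reps"

text \<open>The inner product condition also absorbs the length condition: if the inverse of w makes
  \<open>\<alpha> k\<close> negative, then the word does not stay reduced and, by dominance of
  \<omega>, the inner product is at most 0.\<close>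

lemma reduced_rep_Cons_iff:
  assumes "k \<in> {1..n}"
  shows "reduced_rep (k # is) \<longleftrightarrow> reduced_rep is \<and> word_prod \<alpha> is \<omega> \<bullet> \<alpha> k > 0"
proof (cases "set is \<subseteq> {1..n} \<and> word_prod \<alpha> (rev is) (\<alpha> k) \<in> pos")
  case True
  then have "word_prod \<alpha> (k # is) \<in> reps \<longleftrightarrow> word_prod \<alpha> is \<in> reps \<and> word_prod \<alpha> is \<omega> \<bullet> \<alpha> k > 0"
    using reps_Cons_iff[OF assms] by blast
  moreover have "reduced_word n \<alpha> (k # is) \<longleftrightarrow> reduced_word n \<alpha> is"
    using True assms reduced_word_Cons_iff[of k "is"] by blast
  ultimately show ?thesis by blast
next
  case False
  have "\<not> word_prod \<alpha> is \<omega> \<bullet> \<alpha> k > 0"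
    if "set is \<subseteq> {1..n}" "word_prod \<alpha> (rev is) (\<alpha> k) \<notin> pos"
  proof -
    have "- word_prod \<alpha> (rev is) (\<alpha> k) \<in> pos"
      using that root_cases[OF root_word_prod[of "rev is" "\<alpha> k"]] simple_root[OF assms] by simp
    from pos_inner_weight_nonneg[OF this] have "word_prod \<alpha> (rev is) (\<alpha> k) \<bullet> \<omega> \<le> 0"
      by simp
    then show ?thesis
      by (simp add: word_prod_inner_left inner_commute[of \<omega>])
  qed
  moreover have "\<not> reduced_word n \<alpha> (k # is)" "reduced_word n \<alpha> is \<Longrightarrow> set is \<subseteq> {1..n}"
    using False reduced_word_Cons_iff[of k "is"] reduced_word_subset[of n \<alpha> "is"] by blast+
  ultimately show ?thesis using False by blast
qed

section \<open>Sadness and firing in terms of the attached vector\<close>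

lemma config_weight_coroot:
  assumes "v \<in> {1..n}"
  shows "config_weight c \<bullet> coroot (\<alpha> v) = real (neighbour_sum n \<alpha> I c v) - 2 * real (c v)"
proof -
  \<comment> \<open>The pairing is a nonpositive integer, so neither the floor nor
    \<open>nat\<close> in \<open>edge_weight\<close> loses anything.\<close>
  have weight: "real (edge_weight \<alpha> v u) = - (\<alpha> u \<bullet> coroot (\<alpha> v))" if "u \<in> {1..n}" "u \<noteq> v" for u
  proof -
    have "\<alpha> u \<bullet> coroot (\<alpha> v) \<in> \<int>"
      using crystallographic simple_root that assms by (auto simp: crystallographic_def)
    then obtain z where z: "\<alpha> u \<bullet> coroot (\<alpha> v) = of_int z" by (auto elim: Ints_cases)
    moreover have "z \<le> 0" using simple_inner_coroot_nonpos[of u v] that assms z by simp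
    ultimately show ?thesis
      unfolding edge_weight_def by (simp flip: of_int_minus)
  qed
  \<comment> \<open>Vertices that are not neighbours of \<open>v\<close> have simple roots
    orthogonal to \<open>\<alpha> v\<close>.\<close>
  have "(\<Sum>u\<in>{1..n} - {v}. real (c u) * (\<alpha> u \<bullet> coroot (\<alpha> v)))
      = (\<Sum>u\<in>neighbours n \<alpha> v. real (c u) * (\<alpha> u \<bullet> coroot (\<alpha> v)))"
    by (intro sum.mono_neutral_right) (auto simp: neighbours_def inner_coroot)
  also have "\<dots> = - (\<Sum>u\<in>neighbours n \<alpha> v. real (edge_weight \<alpha> v u * c u))"
    unfolding sum_negf[symmetric] by (intro sum.cong) (auto simp: neighbours_def weight)
  finally have "(\<Sum>u\<in>{1..n}. real (c u) * (\<alpha> u \<bullet> coroot (\<alpha> v)))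
      = 2 * real (c v) - (\<Sum>u\<in>neighbours n \<alpha> v. real (edge_weight \<alpha> v u * c u))"
    using assms by (simp add: sum.remove[of _ v] inner_coroot_self simple_nonzero)
  then show ?thesis
    using weight_coroot[OF assms]
    by (simp add: config_weight_def neighbour_sum_def inner_diff_left inner_sum_left)
qed

lemma sad_iff_config_weight:
  assumes "v \<in> {1..n}"
  shows "sad n \<alpha> I c v \<longleftrightarrow> config_weight c \<bullet> \<alpha> v > 0"
proof -
  have "sad n \<alpha> I c v \<longleftrightarrow> config_weight c \<bullet> coroot (\<alpha> v) > 0"
    using config_weight_coroot[OF assms, of c] by (auto simp: sad_def)
  then show ?thesis using inner_coroot_pos_iff simple_nonzero[OF assms] by blast
qed

lemma config_weight_fire:
  assumes "v \<in> {1..n}" "sad n \<alpha> I c v"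
  shows "config_weight (fire n \<alpha> I v c) = reflection (\<alpha> v) (config_weight c)"
proof -
  \<comment> \<open>Sadness keeps the natural number subtraction in \<open>fire\<close> from being
    truncated.\<close>
  have "real (fire n \<alpha> I v c v) = real (neighbour_sum n \<alpha> I c v) - real (c v)"
    using assms(2) by (simp add: fire_def sad_def of_nat_diff)
  then have "real (fire n \<alpha> I v c v) = real (c v) + config_weight c \<bullet> coroot (\<alpha> v)"
    using config_weight_coroot[OF assms(1), of c] by simp
  moreover have "(\<Sum>u\<in>{1..n} - {v}. real (fire n \<alpha> I v c u) *\<^sub>R \<alpha> u)
      = (\<Sum>u\<in>{1..n} - {v}. real (c u) *\<^sub>R \<alpha> u)"
    by (intro sum.cong) (auto simp: fire_def)
  ultimately show ?thesis
    using assms(1) unfolding reflection_def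
    by (simp add: config_weight_def sum.remove[of _ v] scaleR_left_distrib)
qed

text \<open>The simple roots are independent, but the vector does not see entries outside
  \<open>{1..n}\<close>, hence the second assumption.\<close>

lemma config_weight_inj:
  assumes "config_weight c = config_weight d" "\<forall>i. i \<notin> {1..n} \<longrightarrow> c i = 0 \<and> d i = 0"
  shows "c = d"
proof
  fix i
  have "real (c i) = real (d i)" if "i \<in> {1..n}"
    using assms(1) that simple_coeff_eq[of "\<lambda>j. real (c j)" "\<lambda>j. real (d j)"]
    by (simp add: config_weight_def)
  with assms(2) show "c i = d i" by fastforce
qed

section \<open>Firing sequences and reduced words\<close>

lemma valid_from_append:
  "valid_from n \<alpha> I c (ks @ ls) \<longleftrightarrow>
     valid_from n \<alpha> I c ks \<and> valid_from n \<alpha> I (fold (fire n \<alpha> I) ks c) ls"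
  by (induction ks arbitrary: c) auto

lemma valid_firing_sequence_snoc:
  "valid_firing_sequence n \<alpha> I (ks @ [k]) \<longleftrightarrow>
     valid_firing_sequence n \<alpha> I ks \<and> k \<in> {1..n} \<and> sad n \<alpha> I (config_after n \<alpha> I ks) k"
  by (simp add: valid_firing_sequence_def valid_from_append config_after_def)

lemma config_after_snoc: "config_after n \<alpha> I (ks @ [k]) = fire n \<alpha> I k (config_after n \<alpha> I ks)"
  by (simp add: config_after_def)

lemma valid_firing_sequence_subset: "valid_firing_sequence n \<alpha> I ks \<Longrightarrow> set ks \<subseteq> {1..n}"
  by (induction ks rule: rev_induct) (auto simp: valid_firing_sequence_snoc)

lemma config_weight_config_after:
  "valid_firing_sequence n \<alpha> I ks \<Longrightarrow>
     config_weight (config_after n \<alpha> I ks) = word_prod \<alpha> (rev ks) \<omega>"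
proof (induction ks rule: rev_induct)
  case Nil
  show ?case by (simp add: config_weight_def config_after_def)
next
  case (snoc k ks)
  then show ?case
    by (simp add: valid_firing_sequence_snoc config_after_snoc config_weight_fire)
qed

lemma config_after_outside:
  "set ks \<subseteq> {1..n} \<Longrightarrow> i \<notin> {1..n} \<Longrightarrow> config_after n \<alpha> I ks i = 0"
proof (induction ks rule: rev_induct)
  case Nil
  show ?case by (simp add: config_after_def)
next
  case (snoc k ks)
  then show ?case by (auto simp: config_after_snoc fire_def)
qed

text \<open>The last vertex fired is the first letter of the reversed word, so the induction adds
  vertices at the end; sadness of the new vertex is exactly the inner product condition of
  \<open>reduced_rep_Cons_iff\<close>.\<close>

lemma valid_firing_sequence_iff_reduced_rep:
  "set ks \<subseteq> {1..n} \<Longrightarrow> valid_firing_sequence n \<alpha> I ks \<longleftrightarrow> reduced_rep (rev ks)"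
proof (induction ks rule: rev_induct)
  case Nil
  \<comment> \<open>The identity inverts no positive root.\<close>
  have "reduced_rep []"
    using word_in_reps_iff[of "[]"] not_pos_and_neg by (auto simp: reduced_word_iff)
  then show ?case unfolding valid_firing_sequence_def valid_from.simps rev.simps by blast
next
  case (snoc k ks)
  have k: "k \<in> {1..n}" using snoc.prems by simp
  have IH: "valid_firing_sequence n \<alpha> I ks \<longleftrightarrow> reduced_rep (rev ks)"
    using snoc.prems by (intro snoc.IH) simp
  have "valid_firing_sequence n \<alpha> I (ks @ [k]) \<longleftrightarrow>
      valid_firing_sequence n \<alpha> I ks \<and> word_prod \<alpha> (rev ks) \<omega> \<bullet> \<alpha> k > 0"
    using config_weight_config_after[of ks] sad_iff_config_weight[OF k] k
    by (metis valid_firing_sequence_snoc)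
  with IH show ?case using reduced_rep_Cons_iff[OF k, of "rev ks"] by (simp del: word_prod_Cons)
qed

section \<open>Recovering a representative from its image of the dominant vector\<close>

lemma reps_reduced_word:
  assumes "w \<in> reps"
  obtains "is" where "reduced_rep is" "word_prod \<alpha> is = w"
proof -
  have "w \<in> weyl_group n \<alpha>" using assms by (simp add: min_coset_reps_def)
  then obtain "is" where "reduced_word n \<alpha> is" "word_prod \<alpha> is = w"
    by (rule weyl_group_reduced_word)
  with assms that show thesis by blast
qed

lemma reduced_rep_Cons_inner_neg:
  assumes "reduced_rep (k # is)"
  shows "word_prod \<alpha> (k # is) \<omega> \<bullet> \<alpha> k < 0"
proof -
  have "k \<in> {1..n}" using assms reduced_word_subset by fastforce
  then have "word_prod \<alpha> is \<omega> \<bullet> \<alpha> k > 0" using assms reduced_rep_Cons_iff by blast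
  then show ?thesis by (simp add: reflection_inner_left reflection_self)
qed

text \<open>A left descent of one representative is read off
  from \<open>w \<omega>\<close>, so it is a left descent of the other one too and can be cancelled from both.\<close>

lemma reduced_rep_orbit_inj:
  assumes "reduced_rep is" "reduced_rep js" "word_prod \<alpha> is \<omega> = word_prod \<alpha> js \<omega>"
  shows "word_prod \<alpha> is = word_prod \<alpha> js"
  using assms
proof (induction "is" arbitrary: js)
  case Nil
  show ?case
  proof (cases js)
    case (Cons k ks)
    have k: "k \<in> {1..n}" using Nil Cons reduced_word_subset by fastforce
    have "word_prod \<alpha> js \<omega> \<bullet> \<alpha> k < 0"
      using reduced_rep_Cons_inner_neg[of k ks] Nil.prems(2) unfolding Cons by blast
    \<comment> \<open>A first letter of \<open>js\<close> would contradict dominance of \<omega>, so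
      \<open>js\<close> is empty too.\<close>
    then have "\<omega> \<bullet> \<alpha> k < 0" using Nil.prems(3) by simp
    with pos_inner_weight_nonneg[OF simple_pos[OF k]] show ?thesis by (simp add: inner_commute)
  qed simp
next
  case (Cons k "is")
  have k: "k \<in> {1..n}" using Cons.prems(1) reduced_word_subset by fastforce
  have js: "set js \<subseteq> {1..n}" using Cons.prems(2) reduced_word_subset by blast
  have "word_prod \<alpha> js \<omega> \<bullet> \<alpha> k < 0"
    using reduced_rep_Cons_inner_neg[OF Cons.prems(1)] Cons.prems(3) by simp
  then have "word_prod \<alpha> (rev js) (\<alpha> k) \<bullet> \<omega> < 0"
    by (simp add: word_prod_inner_left inner_commute[of \<omega>])
  \<comment> \<open>A root pairing negatively with \<omega> cannot be positive, so exchange can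
    split off \<open>k\<close> from \<open>js\<close>.\<close>
  then have "- word_prod \<alpha> (rev js) (\<alpha> k) \<in> pos"
    using root_cases[OF root_word_prod, of "rev js" "\<alpha> k"] js simple_root[OF k]
      pos_inner_weight_nonneg by fastforce
  then obtain ls where ls: "set ls \<subseteq> {1..n}" "length js = Suc (length ls)"
      "word_prod \<alpha> ls = reflection (\<alpha> k) \<circ> word_prod \<alpha> js"
    using exchange js simple_pos[OF k] by blast
  then have js_eq: "word_prod \<alpha> js = word_prod \<alpha> (k # ls)" by auto
  \<comment> \<open>This word has the same product and the same length as \<open>js\<close>.\<close>
  then have "reduced_rep (k # ls)"
    using Cons.prems(2) ls(1,2) k
    by (simp add: reduced_word_def del: word_prod_Cons flip: js_eq)
  then have "reduced_rep ls" "reduced_rep is"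
    using Cons.prems(1) reduced_rep_Cons_iff[OF k] by blast+
  moreover have "word_prod \<alpha> is \<omega> = word_prod \<alpha> ls \<omega>"
    using Cons.prems(3) js_eq by (metis comp_apply reflection_reflection word_prod_Cons)
  ultimately have "word_prod \<alpha> is = word_prod \<alpha> ls" using Cons.IH by blast
  then show ?case using js_eq by simp
qed

lemma reps_orbit_map_inj: "inj_on (\<lambda>w. w \<omega>) reps"
proof (rule inj_onI)
  fix w w' assume "w \<in> reps" "w' \<in> reps" "w \<omega> = w' \<omega>"
  then show "w = w'" by (metis reps_reduced_word reduced_rep_orbit_inj)
qed

text \<open>Both sides amount to equality of the attached vectors: for configurations by
  \<open>config_weight_inj\<close>, for group elements by \<open>reps_orbit_map_inj\<close>. One
  direction makes the bijection well defined, the other makes it injective.\<close>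

lemma config_eq_iff:
  assumes "valid_firing_sequence n \<alpha> I ks" "valid_firing_sequence n \<alpha> I ls"
  shows "config_after n \<alpha> I ks = config_after n \<alpha> I ls \<longleftrightarrow>
           word_prod \<alpha> (rev ks) = word_prod \<alpha> (rev ls)"
proof -
  have sub: "set ks \<subseteq> {1..n}" "set ls \<subseteq> {1..n}"
    using assms valid_firing_sequence_subset by blast+
  have "word_prod \<alpha> (rev ks) \<in> reps" "word_prod \<alpha> (rev ls) \<in> reps"
    using assms sub valid_firing_sequence_iff_reduced_rep by blast+
  then have "word_prod \<alpha> (rev ks) = word_prod \<alpha> (rev ls) \<longleftrightarrow>
      word_prod \<alpha> (rev ks) \<omega> = word_prod \<alpha> (rev ls) \<omega>"
    using inj_on_eq_iff[OF reps_orbit_map_inj] by simp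
  also have "\<dots> \<longleftrightarrow> config_after n \<alpha> I ks = config_after n \<alpha> I ls"
    using config_weight_config_after[OF assms(1)] config_weight_config_after[OF assms(2)]
      config_weight_inj config_after_outside sub by metis
  finally show ?thesis by blast
qed

lemma reachable_bij_reps:
  "\<exists>f. bij_betw f (reachable_configs n \<alpha> I) reps \<and>
     (\<forall>ks. valid_firing_sequence n \<alpha> I ks \<longrightarrow> f (config_after n \<alpha> I ks) = word_prod \<alpha> (rev ks))"
proof -
  let ?V = "valid_firing_sequence n \<alpha> I" and ?C = "config_after n \<alpha> I"
  \<comment> \<open>An arbitrary firing sequence reaching \<open>c\<close> is chosen; by
    \<open>config_eq_iff\<close> the product does not depend on the choice.\<close>
  define f where "f c = word_prod \<alpha> (rev (SOME ks. ?V ks \<and> ?C ks = c))" for c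
  have f: "f (?C ks) = word_prod \<alpha> (rev ks)" if "?V ks" for ks
  proof -
    have "?V (SOME ls. ?V ls \<and> ?C ls = ?C ks) \<and> ?C (SOME ls. ?V ls \<and> ?C ls = ?C ks) = ?C ks"
      by (rule someI[of _ ks]) (simp add: that)
    then show ?thesis unfolding f_def using config_eq_iff that by blast
  qed
  have "bij_betw f (reachable_configs n \<alpha> I) reps"
  proof (rule bij_betw_imageI)
    show "inj_on f (reachable_configs n \<alpha> I)"
      by (rule inj_onI) (auto simp: reachable_configs_def f config_eq_iff)
    show "f ` reachable_configs n \<alpha> I = reps"
    proof (intro equalityI subsetI)
      fix w assume "w \<in> f ` reachable_configs n \<alpha> I"
      then obtain ks where "?V ks" "w = word_prod \<alpha> (rev ks)"
        by (auto simp: reachable_configs_def f)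
      then show "w \<in> reps"
        using valid_firing_sequence_iff_reduced_rep valid_firing_sequence_subset by blast
    next
      fix w assume "w \<in> reps"
      then obtain "is" where "is": "reduced_rep is" "word_prod \<alpha> is = w"
        by (rule reps_reduced_word)
      \<comment> \<open>Surjectivity: the letters of a reduced word are fired from right to
        left.\<close>
      then have "?V (rev is)"
        using valid_firing_sequence_iff_reduced_rep[of "rev is"] reduced_word_subset[of n \<alpha> "is"]
        by simp
      with "is" f[of "rev is"] show "w \<in> f ` reachable_configs n \<alpha> I"
        by (auto simp: reachable_configs_def image_iff intro!: exI[of _ "?C (rev is)"])
    qed
  qed
  with f show ?thesis by blast
qed

end

section \<open>Existence of the dominant vector\<close>

lemma (in simple_system) exists_weight:
  "\<exists>\<omega>. \<forall>i\<in>{1..n}. \<omega> \<bullet> coroot (\<alpha> i) = \<epsilon> i"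
proof -
  \<comment> \<open>The factor \<open>(v \<bullet> v) / 2\<close> converts a pairing with the coroot
    into one with the root. The functional \<open>h\<close> with these values is represented by the
    vector \<open>adjoint h 1\<close>.\<close>
  let ?g = "\<lambda>v. \<epsilon> (the_inv_into {1..n} \<alpha> v) * (v \<bullet> v) / 2"
  obtain h :: "'a \<Rightarrow> real" where h: "linear h" "\<forall>v\<in>\<alpha> ` {1..n}. h v = ?g v"
    using linear_independent_extend[OF simple_independent, of ?g] by blast
  have "adjoint h 1 \<bullet> coroot (\<alpha> i) = \<epsilon> i" if "i \<in> {1..n}" for i
  proof -
    have "adjoint h 1 \<bullet> \<alpha> i = \<epsilon> i * (\<alpha> i \<bullet> \<alpha> i) / 2"
      using h that simple_inj adjoint_works[OF h(1), of "\<alpha> i" 1]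
      by (simp add: inner_commute the_inv_into_f_f)
    then show ?thesis using simple_nonzero[OF that] by (simp add: inner_coroot field_simps)
  qed
  then show ?thesis by blast
qed

theorem theorem3p8:
  fixes \<Phi> :: "'a::euclidean_space set"
    and \<alpha> :: "nat \<Rightarrow> 'a"
    and n :: nat
    and I J :: "nat set"
  assumes "root_system \<Phi>" and "crystallographic \<Phi>" and "reduced_roots \<Phi>"
    and "base \<Phi> n \<alpha>"
    and "I \<subseteq> {1..n}"
    and "J = {1..n} - I"
  shows "(\<forall>ks. set ks \<subseteq> {1..n} \<longrightarrow>
            (valid_firing_sequence n \<alpha> I ks \<longleftrightarrow>
               reduced_word n \<alpha> (rev ks) \<and> word_prod \<alpha> (rev ks) \<in> min_coset_reps \<Phi> n \<alpha> J))
       \<and> (\<exists>f. bij_betw f (reachable_configs n \<alpha> I) (min_coset_reps \<Phi> n \<alpha> J)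
            \<and> (\<forall>ks. valid_firing_sequence n \<alpha> I ks \<longrightarrow>
                 f (config_after n \<alpha> I ks) = word_prod \<alpha> (rev ks)))"
proof -
  interpret simple_system \<Phi> n \<alpha>
    using assms by unfold_locales
  obtain \<omega> where "\<forall>i\<in>{1..n}. \<omega> \<bullet> coroot (\<alpha> i) = (if i \<in> I then 1 else 0)"
    using exists_weight[of "\<lambda>i. if i \<in> I then 1 else 0"] by blast
  then interpret kostant_game \<Phi> n \<alpha> I \<omega>
    using assms(5) by unfold_locales auto
  show ?thesis
    using valid_firing_sequence_iff_reduced_rep reachable_bij_reps assms(6) by blast
qed

end
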